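(* Let $F$ be a free group of finite rank. Every regular subset $R\subseteq F$ is either thick or sparse.
   Context: $F$ is the free group with finite basis $X=\{x_1,\dots,x_m\}$, identified with the set of freely reduced words in $X\cup X^{-1}$; $|w|$ is the length of $w$. For $s\in(0,1)$ let $\mu_s$ be the atomic probability measure on $F$ with $\mu_s(1)=s$ and $\mu_s(w)=\frac{s(1-s)^{|w|}}{2m(2m-1)^{|w|-1}}$ for $w\neq1$. For $R\subseteq F$ put $\mu_0(R)=\lim_{s\to0^+}\mu_s(R)$ and $\mu_1(R)=\lim_{s\to0^+}\mu_s(R)/s$, when these limits exist (as finite numbers). $R$ is thick if $\mu_0(R)$ exists and $\mu_0(R)>0$; $R$ is sparse if $\mu_0(R)=0$ and $\mu_1(R)$ exists. A subset of $F$ is regular if, as a set of (freely reduced) words over the alphabet $X\cup X^{-1}$, it is the language accepted by a finite deterministic automaton. *)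

theory Defs
  imports "HOL-Probability.Probability" "HOL-Algebra.Group"
begin

section \<open>The free group as a set of freely reduced words\<close>

text \<open>The letter \<open>(x, True)\<close> stands for the generator \<open>x\<close>, and \<open>(x, False)\<close> for its formal
  inverse.\<close>

type_synonym 'x letter = "'x \<times> bool"

definition letters :: "'x set \<Rightarrow> 'x letter set" where
  "letters X = X \<times> UNIV"

definition inv_letter :: "'x letter \<Rightarrow> 'x letter" where
  "inv_letter a = (fst a, \<not> snd a)"

definition reduced :: "'x letter list \<Rightarrow> bool" where
  "reduced w \<longleftrightarrow> successively (\<lambda>a b. b \<noteq> inv_letter a) w"

text \<open>For a reduced word \<open>w\<close>, the word \<open>reduced_cons a w\<close> is the reduced form of \<open>a # w\<close>.\<close>

definition reduced_cons :: "'x letter \<Rightarrow> 'x letter list \<Rightarrow> 'x letter list" where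
  "reduced_cons a w = (if w \<noteq> [] \<and> hd w = inv_letter a then tl w else a # w)"

definition free_group :: "'x set \<Rightarrow> 'x letter list monoid" where
  "free_group X =
     \<lparr>carrier = {w \<in> lists (letters X). reduced w},
      mult = foldr reduced_cons,
      one = []\<rparr>"

lemma inv_letter_inv_letter [simp]: "inv_letter (inv_letter a) = a"
  by (simp add: inv_letter_def)

lemma inv_letter_neq [simp]: "inv_letter a \<noteq> a" "a \<noteq> inv_letter a"
  by (simp_all add: inv_letter_def prod_eq_iff)

lemma inv_letter_in_letters [simp]: "inv_letter a \<in> letters X \<longleftrightarrow> a \<in> letters X"
  by (cases a) (simp add: letters_def inv_letter_def)

lemma carrier_free_group: "carrier (free_group X) = {w \<in> lists (letters X). reduced w}"
  by (simp add: free_group_def)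

lemma reduced_Nil [simp]: "reduced []"
  by (simp add: reduced_def)

lemma reduced_Cons: "reduced (a # w) \<longleftrightarrow> (w = [] \<or> hd w \<noteq> inv_letter a) \<and> reduced w"
  by (auto simp: reduced_def successively_Cons)

lemma reduced_reduced_cons: "reduced w \<Longrightarrow> reduced (reduced_cons a w)"
  by (cases w) (auto simp: reduced_cons_def reduced_Cons)

lemma reduced_cons_in_lists:
  "a \<in> letters X \<Longrightarrow> w \<in> lists (letters X) \<Longrightarrow> reduced_cons a w \<in> lists (letters X)"
  by (cases w) (auto simp: reduced_cons_def)

lemma reduced_cons_eq: "reduced (a # w) \<Longrightarrow> reduced_cons a w = a # w"
  by (auto simp: reduced_cons_def reduced_Cons)

lemma reduced_cons_cancel:
  "reduced w \<Longrightarrow> reduced_cons (inv_letter a) (reduced_cons a w) = w"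
  by (cases w) (auto simp: reduced_cons_def reduced_Cons)

lemma reduced_foldr: "reduced v \<Longrightarrow> reduced (foldr reduced_cons u v)"
  by (induction u) (auto intro: reduced_reduced_cons)

lemma foldr_in_lists:
  "u \<in> lists (letters X) \<Longrightarrow> v \<in> lists (letters X) \<Longrightarrow>
     foldr reduced_cons u v \<in> lists (letters X)"
  by (induction u) (simp_all add: reduced_cons_in_lists del: in_lists_conv_set)

lemma foldr_reduced_cons_step:
  assumes "reduced v" "reduced w"
  shows "foldr reduced_cons (reduced_cons a v) w = reduced_cons a (foldr reduced_cons v w)"
proof (cases "v \<noteq> [] \<and> hd v = inv_letter a")
  case True
  then obtain v' where v: "v = inv_letter a # v'"
    by (cases v) auto
  show ?thesis
    using reduced_cons_cancel[OF reduced_foldr[OF assms(2)], of "inv_letter a" v']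
    by (simp add: v reduced_cons_def[of a "inv_letter a # v'"])
qed (auto simp: reduced_cons_def[of a v])

lemma foldr_reduced_cons_assoc:
  assumes "reduced v" "reduced w"
  shows "foldr reduced_cons (foldr reduced_cons u v) w
           = foldr reduced_cons u (foldr reduced_cons v w)"
  using assms by (induction u) (simp_all add: foldr_reduced_cons_step reduced_foldr)

lemma foldr_reduced_cons_Nil: "reduced w \<Longrightarrow> foldr reduced_cons w [] = w"
  by (induction w) (auto simp: reduced_cons_eq reduced_Cons)

lemma reduced_inverse: "reduced w \<Longrightarrow> reduced (rev (map inv_letter w))"
  unfolding reduced_def by (auto simp: successively_map elim!: successively_mono)

lemma foldr_reduced_cons_inverse:
  "reduced v \<Longrightarrow>
     foldr reduced_cons (rev (map inv_letter w)) (foldr reduced_cons w v) = v"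
  by (induction w) (simp_all add: reduced_cons_cancel reduced_foldr)

lemma group_free_group: "group (free_group X)"
proof (rule groupI)
  fix w assume "w \<in> carrier (free_group X)"
  then have w: "w \<in> lists (letters X)" "reduced w"
    by (auto simp: carrier_free_group)
  let ?v = "rev (map inv_letter w)"
  have "foldr reduced_cons ?v w = []"
    using foldr_reduced_cons_inverse[of "[]" w] w by (simp add: foldr_reduced_cons_Nil)
  moreover have "?v \<in> carrier (free_group X)"
    using w by (auto simp: carrier_free_group intro: reduced_inverse)
  ultimately show
    "\<exists>v\<in>carrier (free_group X). v \<otimes>\<^bsub>free_group X\<^esub> w = \<one>\<^bsub>free_group X\<^esub>"
    by (auto simp: free_group_def)
next
  fix u v assume "u \<in> carrier (free_group X)" "v \<in> carrier (free_group X)"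
  then show "u \<otimes>\<^bsub>free_group X\<^esub> v \<in> carrier (free_group X)"
    using foldr_in_lists[of u X v] reduced_foldr[of v u] by (simp add: free_group_def)
qed (auto simp: free_group_def foldr_reduced_cons_assoc)


section \<open>The measures and their asymptotics\<close>

definition mu_weight :: "'x set \<Rightarrow> real \<Rightarrow> 'x letter list \<Rightarrow> real" where
  "mu_weight X s w =
     (if w = [] then s
      else s * (1 - s) ^ length w /
           (2 * real (card X) * (2 * real (card X) - 1) ^ (length w - 1)))"

definition mu :: "'x set \<Rightarrow> real \<Rightarrow> 'x letter list measure" where
  "mu X s = point_measure (carrier (free_group X)) (\<lambda>w. ennreal (mu_weight X s w))"

definition mu0_is :: "'x set \<Rightarrow> 'x letter list set \<Rightarrow> real \<Rightarrow> bool" where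
  "mu0_is X R l \<longleftrightarrow> ((\<lambda>s. measure (mu X s) R) \<longlongrightarrow> l) (at_right 0)"

definition mu1_is :: "'x set \<Rightarrow> 'x letter list set \<Rightarrow> real \<Rightarrow> bool" where
  "mu1_is X R l \<longleftrightarrow> ((\<lambda>s. measure (mu X s) R / s) \<longlongrightarrow> l) (at_right 0)"

definition thick_subset :: "'x set \<Rightarrow> 'x letter list set \<Rightarrow> bool" where
  "thick_subset X R \<longleftrightarrow> (\<exists>l. mu0_is X R l \<and> l > 0)"

definition sparse_subset :: "'x set \<Rightarrow> 'x letter list set \<Rightarrow> bool" where
  "sparse_subset X R \<longleftrightarrow> mu0_is X R 0 \<and> (\<exists>l. mu1_is X R l)"

lemma not_thick_and_sparse: "\<not> (thick_subset X R \<and> sparse_subset X R)"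
proof
  assume "thick_subset X R \<and> sparse_subset X R"
  then obtain l where "mu0_is X R l" "l > 0" "mu0_is X R 0"
    by (auto simp: thick_subset_def sparse_subset_def)
  then show False
    using tendsto_unique[of "at_right (0::real)" "\<lambda>s. measure (mu X s) R" l 0]
    by (auto simp: mu0_is_def)
qed

definition words_of_length :: "'x set \<Rightarrow> nat \<Rightarrow> 'x letter list set" where
  "words_of_length X n = {w \<in> carrier (free_group X). length w = n}"

lemma finite_letters: "finite X \<Longrightarrow> finite (letters X)"
  by (simp add: letters_def)

lemma card_letters: "card (letters X) = 2 * card X"
  by (simp add: letters_def card_cartesian_product)

lemma finite_words_of_length:
  assumes "finite X" shows "finite (words_of_length X n)"
  by (rule finite_subset[OF _ finite_lists_length_eq[OF finite_letters[OF assms], of n]])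
     (auto simp: words_of_length_def carrier_free_group)

lemma card_words_of_length:
  assumes X: "finite X"
  shows "card (words_of_length X (Suc n)) = 2 * card X * (2 * card X - 1) ^ n"
proof (induction n)
  case 0
  have "words_of_length X (Suc 0) = (\<lambda>a. [a]) ` letters X"
    by (auto simp: words_of_length_def carrier_free_group reduced_Cons length_Suc_conv)
  then show ?case
    by (simp add: card_image inj_on_def card_letters)
next
  case (Suc n)
  let ?W = "words_of_length X (Suc n)"
  let ?S = "SIGMA w:?W. letters X - {inv_letter (hd w)}"
  have eq: "words_of_length X (Suc (Suc n)) = (\<lambda>(w, a). a # w) ` ?S" (is "?L = ?R")
  proof (rule Set.set_eqI)
    fix u
    show "u \<in> ?L \<longleftrightarrow> u \<in> ?R"
    proof
      assume "u \<in> ?L"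
      then obtain a w where u: "u = a # w" and "w \<in> ?W" "a \<in> letters X" "hd w \<noteq> inv_letter a"
        by (cases u) (auto simp: words_of_length_def carrier_free_group reduced_Cons)
      then have "(w, a) \<in> ?S"
        by auto
      then show "u \<in> ?R"
        unfolding u by force
    qed (auto simp: words_of_length_def carrier_free_group reduced_Cons)
  qed
  have hd: "hd w \<in> letters X" if "w \<in> ?W" for w
    using that by (cases w) (auto simp: words_of_length_def carrier_free_group)
  have "card (words_of_length X (Suc (Suc n))) = card ?S"
    unfolding eq by (rule card_image) (auto simp: inj_on_def)
  also have "\<dots> = (\<Sum>w\<in>?W. card (letters X - {inv_letter (hd w)}))"
    by (rule card_SigmaI) (use X in \<open>auto simp: finite_words_of_length finite_letters\<close>)
  also have "\<dots> = (\<Sum>w\<in>?W. 2 * card X - 1)"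
    by (intro sum.cong refl) (use X hd in \<open>simp add: card_Diff_singleton card_letters\<close>)
  finally show ?case
    by (simp add: Suc.IH)
qed

lemma emeasure_mu_words_of_length:
  assumes "finite X" "X \<noteq> {}" "0 < s" "s < 1"
  shows "emeasure (mu X s) (words_of_length X n) = ennreal (s * (1 - s) ^ n)"
proof -
  have pos: "card X > 0"
    using assms by (simp add: card_gt_0_iff)
  have nonneg: "mu_weight X s w \<ge> 0" for w
    using assms pos by (simp add: mu_weight_def)
  have "emeasure (mu X s) (words_of_length X n)
          = (\<Sum>w\<in>words_of_length X n. ennreal (mu_weight X s w))"
    unfolding mu_def
    by (rule emeasure_point_measure_finite2)
       (use assms finite_words_of_length in \<open>auto simp: words_of_length_def\<close>)
  also have "\<dots> = ennreal (\<Sum>w\<in>words_of_length X n. mu_weight X s w)"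
    using nonneg by (simp add: sum_ennreal)
  also have "(\<Sum>w\<in>words_of_length X n. mu_weight X s w) = s * (1 - s) ^ n"
  proof (cases n)
    case 0
    then have "words_of_length X n = {[]}"
      by (auto simp: words_of_length_def carrier_free_group)
    then show ?thesis
      by (simp add: 0 mu_weight_def)
  next
    case (Suc k)
    let ?c = "2 * real (card X) * (2 * real (card X) - 1) ^ k"
    have "real (2 * card X - 1) = 2 * real (card X) - 1"
      using pos by (simp add: of_nat_diff)
    then have card: "real (card (words_of_length X n)) = ?c"
      by (simp add: Suc card_words_of_length[OF assms(1)])
    have "(\<Sum>w\<in>words_of_length X n. mu_weight X s w)
            = (\<Sum>w\<in>words_of_length X n. s * (1 - s) ^ n / ?c)"
      by (intro sum.cong refl) (auto simp: words_of_length_def mu_weight_def Suc)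
    also have "\<dots> = ?c * (s * (1 - s) ^ n / ?c)"
      by (simp add: card)
    also have "\<dots> = s * (1 - s) ^ n"
      using pos by (subst nonzero_mult_div_cancel_left[symmetric, of ?c]) auto
    finally show ?thesis .
  qed
  finally show ?thesis .
qed

lemma prob_space_mu:
  assumes "finite X" "X \<noteq> {}" "0 < s" "s < 1"
  shows "prob_space (mu X s)"
proof
  have sp: "space (mu X s) = (\<Union>n. words_of_length X n)"
    by (auto simp: mu_def space_point_measure words_of_length_def)
  have "(\<Sum>n. emeasure (mu X s) (words_of_length X n))
          = emeasure (mu X s) (\<Union>n. words_of_length X n)"
    by (rule suminf_emeasure)
       (auto simp: mu_def sets_point_measure words_of_length_def disjoint_family_on_def)
  also have "(\<Sum>n. emeasure (mu X s) (words_of_length X n)) = (\<Sum>n. ennreal (s * (1 - s) ^ n))"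
    by (simp add: emeasure_mu_words_of_length[OF assms])
  also have "\<dots> = ennreal (s * (1 / (1 - (1 - s))))"
  proof (rule suminf_ennreal_eq)
    show "(\<lambda>n. s * (1 - s) ^ n) sums (s * (1 / (1 - (1 - s))))"
      by (rule sums_mult, rule geometric_sums) (use assms in simp)
  qed (use assms in simp)
  finally show "emeasure (mu X s) (space (mu X s)) = 1"
    using assms by (simp add: sp)
qed


section \<open>Regular sets\<close>

text \<open>States are natural numbers without loss of generality, the state set being finite.  The
  automaton is complete: its transition function maps \<open>dfa_states M \<times> A\<close> to \<open>dfa_states M\<close>.\<close>

record 'a dfa =
  dfa_states :: "nat set"
  dfa_init :: nat
  dfa_final :: "nat set"
  dfa_step :: "nat \<Rightarrow> 'a \<Rightarrow> nat"

definition is_dfa :: "'a set \<Rightarrow> 'a dfa \<Rightarrow> bool" where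
  "is_dfa A M \<longleftrightarrow>
     finite (dfa_states M) \<and> dfa_init M \<in> dfa_states M \<and> dfa_final M \<subseteq> dfa_states M \<and>
     (\<forall>q\<in>dfa_states M. \<forall>a\<in>A. dfa_step M q a \<in> dfa_states M)"

definition dfa_language :: "'a set \<Rightarrow> 'a dfa \<Rightarrow> 'a list set" where
  "dfa_language A M = {w \<in> lists A. foldl (dfa_step M) (dfa_init M) w \<in> dfa_final M}"

definition regular_language :: "'a set \<Rightarrow> 'a list set \<Rightarrow> bool" where
  "regular_language A L \<longleftrightarrow> (\<exists>M. is_dfa A M \<and> L = dfa_language A M)"

definition regular_subset :: "'x set \<Rightarrow> 'x letter list set \<Rightarrow> bool" where
  "regular_subset X R \<longleftrightarrow> R \<subseteq> carrier (free_group X) \<and> regular_language (letters X) R"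

end

theory Submission
  imports Defs "HOL-Computational_Algebra.Polynomial"
begin

text \<open>
  Let \<open>f n\<close> be the proportion of reduced words of length \<open>n\<close> that lie in \<open>R\<close>.  The measure
  \<open>mu X s\<close> gives total mass \<open>s * (1 - s) ^ n\<close> to the words of length \<open>n\<close>, if there are any, and
  spreads it evenly, so the measure of \<open>R\<close> is \<open>s * h s\<close> with \<open>h s = (\<Sum>n. f n * (1 - s) ^ n)\<close>.

  The point is that \<open>h\<close> is a rational function of \<open>s\<close>.  For an automaton with \<open>k\<close> states, the
  vectors that list, for each state, the number of accepted words of length \<open>n\<close> read from that state
  arise from one another by a fixed linear map of a \<open>k\<close>-dimensional space.  The first \<open>k + 1\<close> of
  them are linearly dependent, and applying the map propagates the dependence to a linear recurrence
  for the counts (\<open>regular_language_growth_recurrence\<close>).  As the automaton accepts exactly the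
  reduced words in \<open>R\<close>, all words over the alphabet may be run through it, and the vectors need to
  be indexed by states only, not by pairs of a state and a last letter.  Normalising by the sphere
  sizes, which are geometric, keeps the recurrence, and a power series whose coefficients satisfy a
  linear recurrence is rational
  (\<open>recurrence_imp_rational_power_series\<close>).

  Finally \<open>0 \<le> f n \<le> 1\<close> forces \<open>0 \<le> s * h s \<le> 1\<close>, so that \<open>h\<close> has at most a simple pole at \<open>0\<close>
  (\<open>rational_at_most_simple_pole\<close>).  If there is a pole, then \<open>s * h s\<close> tends to a nonzero residue,
  which is positive because \<open>h\<close> is nonnegative, and \<open>R\<close> is thick.  If there is none, then \<open>h\<close> itself
  has a finite limit, and \<open>R\<close> is sparse.
\<close>

section \<open>Growth of regular languages\<close>

text \<open>Gaussian elimination: the equation \<open>x\<close> serves to eliminate an unknown \<open>k\<close> that occurs in it,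
  and the smaller system, with coefficients \<open>b\<close>, is solved by induction.\<close>

lemma homogeneous_system_nontrivial_solution:
  fixes a :: "'j \<Rightarrow> 'i \<Rightarrow> 'a :: field"
  assumes "finite S" "finite J" "card S < card J"
  shows "\<exists>c. (\<exists>j\<in>J. c j \<noteq> 0) \<and> (\<forall>x\<in>S. (\<Sum>j\<in>J. c j * a j x) = 0)"
  using assms
proof (induction S arbitrary: J a rule: finite_induct)
  case empty
  then have "J \<noteq> {}"
    by auto
  then show ?case
    by (intro exI[of _ "\<lambda>_. 1"]) auto
next
  case (insert x S)
  show ?case
  proof (cases "\<forall>j\<in>J. a j x = 0")
    case True
    have "card S < card J"
      using insert by simp
    with insert.IH[of J a] insert.prems(1) True show ?thesis
      by auto
  next
    case False
    then obtain k where k: "k \<in> J" "a k x \<noteq> 0"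
      by auto
    define b where "b j y = a j y - a j x / a k x * a k y" for j y
    have "card S < card (J - {k})"
      using insert k by simp
    with insert.IH[of "J - {k}" b] insert.prems(1)
    obtain c where c: "\<exists>j\<in>J - {k}. c j \<noteq> 0" "\<forall>y\<in>S. (\<Sum>j\<in>J - {k}. c j * b j y) = 0"
      by auto
    define c' where "c' = c(k := - (\<Sum>j\<in>J - {k}. c j * (a j x / a k x)))"
    have sum_c': "(\<Sum>j\<in>J. c' j * a j y) = (\<Sum>j\<in>J - {k}. c j * b j y)" for y
    proof -
      have "(\<Sum>j\<in>J. c' j * a j y) = c' k * a k y + (\<Sum>j\<in>J - {k}. c' j * a j y)"
        using insert.prems(1) k by (simp add: sum.remove)
      also have "(\<Sum>j\<in>J - {k}. c' j * a j y) = (\<Sum>j\<in>J - {k}. c j * a j y)"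
        by (intro sum.cong) (auto simp: c'_def)
      also have "c' k * a k y = - (\<Sum>j\<in>J - {k}. c j * (a j x / a k x * a k y))"
        by (simp add: c'_def sum_distrib_right mult.assoc)
      finally show ?thesis
        by (simp add: b_def right_diff_distrib sum_subtractf)
    qed
    have "\<exists>j\<in>J. c' j \<noteq> 0"
      using c(1) by (auto simp: c'_def)
    moreover have "b j x = 0" for j
      using k by (simp add: b_def)
    ultimately show ?thesis
      using c(2) by (intro exI[of _ c']) (auto simp: sum_c')
  qed
qed

definition accepted_count :: "'a set \<Rightarrow> 'a dfa \<Rightarrow> nat \<Rightarrow> nat \<Rightarrow> nat" where
  "accepted_count A M n q =
     card {w \<in> lists A. length w = n \<and> foldl (dfa_step M) q w \<in> dfa_final M}"

lemma accepted_count_Suc: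
  assumes "finite A"
  shows "accepted_count A M (Suc n) q = (\<Sum>a\<in>A. accepted_count A M n (dfa_step M q a))"
proof -
  let ?W = "\<lambda>n q. {w \<in> lists A. length w = n \<and> foldl (dfa_step M) q w \<in> dfa_final M}"
  have fin: "finite (?W n q)" for n q
    by (rule finite_subset[OF _ finite_lists_length_eq[OF assms, of n]]) auto
  have "?W (Suc n) q = (\<Union>a\<in>A. (#) a ` ?W n (dfa_step M q a))"
    by (auto simp: length_Suc_conv image_iff)
  also have "card \<dots> = (\<Sum>a\<in>A. card ((#) a ` ?W n (dfa_step M q a)))"
    by (rule card_UN_disjoint) (use assms fin in auto)
  also have "\<dots> = (\<Sum>a\<in>A. card (?W n (dfa_step M q a)))"
    by (intro sum.cong refl card_image) auto
  finally show ?thesis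
    by (simp only: accepted_count_def)
qed

text \<open>Reading one more letter acts linearly on the vectors of counts indexed by the states, so a
  linear dependence among the first few of these vectors persists when all lengths are shifted by
  \<open>n\<close>.\<close>

lemma regular_language_growth_recurrence:
  assumes "finite A" "regular_language A L"
  obtains c :: "nat \<Rightarrow> real" and d i where "i \<le> d" "c i \<noteq> 0"
    "\<And>n. (\<Sum>j\<le>d. c j * real (card {w \<in> L. length w = n + j})) = 0"
proof -
  obtain M where M: "is_dfa A M" and L: "L = dfa_language A M"
    using assms(2) by (auto simp: regular_language_def)
  let ?N = "\<lambda>n q. real (accepted_count A M n q)"
  define d where "d = card (dfa_states M)"
  have "\<exists>c. (\<exists>j\<in>{..d}. c j \<noteq> 0) \<and> (\<forall>q\<in>dfa_states M. (\<Sum>j\<le>d. c j * ?N j q) = 0)"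
    by (rule homogeneous_system_nontrivial_solution)
       (use M in \<open>auto simp: is_dfa_def d_def\<close>)
  then obtain c i where c: "i \<le> d" "c i \<noteq> 0"
      and dep: "\<And>q. q \<in> dfa_states M \<Longrightarrow> (\<Sum>j\<le>d. c j * ?N j q) = 0"
    by auto
  have rec: "(\<Sum>j\<le>d. c j * ?N (n + j) q) = 0" if "q \<in> dfa_states M" for n q
    using that
  proof (induction n arbitrary: q)
    case 0
    then show ?case
      by (simp add: dep)
  next
    case (Suc n)
    have "(\<Sum>j\<le>d. c j * ?N (Suc n + j) q)
            = (\<Sum>j\<le>d. \<Sum>a\<in>A. c j * ?N (n + j) (dfa_step M q a))"
      by (simp add: accepted_count_Suc[OF assms(1)] sum_distrib_left)
    also have "\<dots> = (\<Sum>a\<in>A. \<Sum>j\<le>d. c j * ?N (n + j) (dfa_step M q a))"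
      by (rule sum.swap)
    also have "\<dots> = 0"
      using M Suc by (intro sum.neutral ballI Suc.IH) (auto simp: is_dfa_def)
    finally show ?case .
  qed
  have "{w \<in> L. length w = n}
          = {w \<in> lists A. length w = n \<and> foldl (dfa_step M) (dfa_init M) w \<in> dfa_final M}" for n
    by (auto simp: L dfa_language_def)
  then have "card {w \<in> L. length w = n} = accepted_count A M n (dfa_init M)" for n
    by (simp only: accepted_count_def)
  with rec[of "dfa_init M"] M have "(\<Sum>j\<le>d. c j * real (card {w \<in> L. length w = n + j})) = 0" for n
    by (simp add: is_dfa_def)
  from that[OF c this] show ?thesis .
qed

section \<open>Rational power series and their behaviour at a pole\<close>

text \<open>The denominator is the reversed characteristic polynomial of the recurrence: in its product
  with the series all coefficients from the \<open>d\<close>-th on vanish.\<close>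

lemma recurrence_imp_rational_power_series:
  fixes a c :: "nat \<Rightarrow> real"
  assumes c: "i \<le> d" "c i \<noteq> 0" and rec: "\<And>n. (\<Sum>j\<le>d. c j * a (n + j)) = 0"
  obtains p q :: "real poly" where "q \<noteq> 0"
    "\<And>t. summable (\<lambda>n. a n * t ^ n) \<Longrightarrow> poly q t * (\<Sum>n. a n * t ^ n) = poly p t"
proof
  define q where "q = (\<Sum>j\<le>d. monom (c j) (d - j))"
  define p where "p = (\<Sum>j\<le>d. monom (c j) (d - j) * (\<Sum>n<j. monom (a n) n))"
  have "coeff q (d - i) = (\<Sum>j\<le>d. if j = i then c j else 0)"
    unfolding q_def coeff_sum using c(1) by (intro sum.cong) auto
  with c show "q \<noteq> 0"
    by auto
  fix t
  assume sm: "summable (\<lambda>n. a n * t ^ n)"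
  have shifted: "summable (\<lambda>n. t ^ j * (a (n + j) * t ^ n))" for j
    using summable_ignore_initial_segment[OF sm, of j] by (simp add: power_add ac_simps)
  have split: "c j * t ^ (d - j) * (\<Sum>n. a n * t ^ n)
      = c j * t ^ (d - j) * (\<Sum>n<j. a n * t ^ n) + (\<Sum>n. t ^ d * t ^ n * (c j * a (n + j)))"
    if "j \<le> d" for j
  proof -
    have pow: "t ^ (d - j) * t ^ j = t ^ d"
      using that by (simp flip: power_add)
    then have eq: "t ^ d * t ^ n * (c j * a (n + j))
        = c j * t ^ (d - j) * (t ^ j * (a (n + j) * t ^ n))" for n
      by (simp add: ac_simps flip: pow)
    have "(\<Sum>n. t ^ d * t ^ n * (c j * a (n + j)))
        = c j * t ^ (d - j) * (\<Sum>n. t ^ j * (a (n + j) * t ^ n))"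
      unfolding eq by (rule suminf_mult) (rule shifted)
    moreover have "(\<Sum>n. a n * t ^ n) = (\<Sum>n<j. a n * t ^ n) + (\<Sum>n. t ^ j * (a (n + j) * t ^ n))"
      using suminf_split_initial_segment[OF sm, of j] by (simp add: power_add ac_simps)
    ultimately show ?thesis
      by (simp add: distrib_left)
  qed
  have term_summable: "summable (\<lambda>n. t ^ d * t ^ n * (c j * a (n + j)))" if "j \<le> d" for j
  proof -
    have pow: "t ^ (d - j) * t ^ j = t ^ d"
      using that by (simp flip: power_add)
    then show ?thesis
      using summable_mult[OF shifted[of j], of "c j * t ^ (d - j)"]
      by (simp add: ac_simps flip: pow)
  qed
  have "poly q t * (\<Sum>n. a n * t ^ n) = (\<Sum>j\<le>d. c j * t ^ (d - j) * (\<Sum>n. a n * t ^ n))"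
    by (simp add: q_def poly_sum poly_monom sum_distrib_right)
  also have "\<dots> = (\<Sum>j\<le>d. c j * t ^ (d - j) * (\<Sum>n<j. a n * t ^ n)) +
      (\<Sum>j\<le>d. \<Sum>n. t ^ d * t ^ n * (c j * a (n + j)))"
    by (simp add: split sum.distrib)
  also have "(\<Sum>j\<le>d. \<Sum>n. t ^ d * t ^ n * (c j * a (n + j)))
      = (\<Sum>n. \<Sum>j\<le>d. t ^ d * t ^ n * (c j * a (n + j)))"
    by (rule suminf_sum[symmetric]) (use term_summable in auto)
  also have "\<dots> = 0"
    by (simp add: rec flip: sum_distrib_left)
  finally show "poly q t * (\<Sum>n. a n * t ^ n) = poly p t"
    by (simp add: p_def poly_sum poly_monom)
qed

text \<open>Common factors \<open>s\<close> of numerator and denominator are cancelled until one of them is nonzero at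
  \<open>0\<close>.  Boundedness of \<open>s * h s\<close> rules out a pole of higher order: if \<open>q = s * r\<close> with \<open>r\<close>
  vanishing at \<open>0\<close>, then \<open>p s = r s * (s * h s)\<close> tends to \<open>0\<close>, and there is still a common
  factor.\<close>

lemma rational_at_most_simple_pole:
  fixes p q :: "real poly" and h :: "real \<Rightarrow> real"
  assumes "q \<noteq> 0" "\<forall>\<^sub>F s in at_right 0. poly q s * h s = poly p s"
    and bounded: "\<forall>\<^sub>F s in at_right 0. \<bar>s * h s\<bar> \<le> B"
  shows "(\<exists>l. l \<noteq> 0 \<and> ((\<lambda>s. s * h s) \<longlongrightarrow> l) (at_right 0)) \<or> (\<exists>l. (h \<longlongrightarrow> l) (at_right 0))"
  using assms(1,2)
proof (induction "degree q" arbitrary: p q rule: less_induct)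
  case less
  have lim: "((\<lambda>s. poly r s) \<longlongrightarrow> poly r 0) (at_right 0)" for r :: "real poly"
    by (intro tendsto_intros)
  have quotient: "(g \<longlongrightarrow> poly p 0 / poly r 0) (at_right 0)"
    if "poly r 0 \<noteq> 0" "\<forall>\<^sub>F s in at_right 0. poly r s * g s = poly p s" for g r
  proof (rule Lim_transform_eventually)
    show "((\<lambda>s. poly p s / poly r s) \<longlongrightarrow> poly p 0 / poly r 0) (at_right 0)"
      by (intro tendsto_divide lim that)
    have "\<forall>\<^sub>F s in at_right 0. poly r s \<noteq> 0"
      using tendsto_imp_eventually_ne[OF lim that(1)] .
    with that(2) show "\<forall>\<^sub>F s in at_right 0. poly p s / poly r s = g s"
      by eventually_elim (simp add: field_simps)
  qed
  show ?case
  proof (cases "poly q 0 = 0")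
    case False
    then show ?thesis
      using quotient[OF False less.prems(2)] by blast
  next
    case True
    then obtain r where q: "q = [:0, 1:] * r"
      by (auto simp: poly_eq_0_iff_dvd dvd_def)
    then have r: "r \<noteq> 0"
      using less.prems(1) by auto
    have eq: "\<forall>\<^sub>F s in at_right 0. poly r s * (s * h s) = poly p s"
      using less.prems(2) by eventually_elim (simp add: q ac_simps)
    show ?thesis
    proof (cases "poly p 0 = 0")
      case True
      then obtain p' where p: "p = [:0, 1:] * p'"
        by (auto simp: poly_eq_0_iff_dvd dvd_def)
      have "degree r < degree q"
        using r by (simp add: q)
      moreover have "\<forall>\<^sub>F s in at_right 0. poly r s * h s = poly p' s"
        using eq eventually_at_right_less[of 0] by eventually_elim (simp add: p)
      ultimately show ?thesis
        using less.hyps r by blast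
    next
      case False
      have "poly r 0 \<noteq> 0"
      proof
        assume "poly r 0 = 0"
        then have "Zfun (poly r) (at_right 0)"
          using lim[of r] by (simp add: tendsto_Zfun_iff)
        moreover have "Bfun (\<lambda>s. s * h s) (at_right 0)"
          using bounded by (intro BfunI[of _ B]) simp
        ultimately have "Zfun (\<lambda>s. poly r s * (s * h s)) (at_right 0)"
          by (rule bounded_bilinear.Zfun_prod_Bfun[OF bounded_bilinear_mult])
        then have "((\<lambda>s. poly r s * (s * h s)) \<longlongrightarrow> 0) (at_right 0)"
          by (simp add: tendsto_Zfun_iff)
        then have "(poly p \<longlongrightarrow> 0) (at_right 0)"
          using Lim_transform_eventually[OF _ eq] by blast
        with lim[of p] False show False
          using tendsto_unique[OF trivial_limit_at_right_real] by blast
      qed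
      moreover from quotient[OF this eq]
      have "((\<lambda>s. s * h s) \<longlongrightarrow> poly p 0 / poly r 0) (at_right 0)" .
      ultimately show ?thesis
        using False by (intro disjI1 exI[of _ "poly p 0 / poly r 0"]) simp
    qed
  qed
qed

section \<open>Relative frequencies on spheres\<close>

definition frequency :: "'x set \<Rightarrow> 'x letter list set \<Rightarrow> nat \<Rightarrow> real" where
  "frequency X R n = real (card {w \<in> R. length w = n}) / real (card (words_of_length X n))"

lemma frequency_bounds:
  assumes "finite X" "R \<subseteq> carrier (free_group X)"
  shows "0 \<le> frequency X R n" "frequency X R n \<le> 1"
proof -
  have "card {w \<in> R. length w = n} \<le> card (words_of_length X n)"
    by (rule card_mono) (use assms finite_words_of_length in \<open>auto simp: words_of_length_def\<close>)
  then show "frequency X R n \<le> 1"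
    by (auto simp: frequency_def divide_le_eq_1)
qed (simp add: frequency_def)

lemma frequency_Suc:
  assumes "finite X"
  shows "frequency X R (Suc n) = real (card {w \<in> R. length w = Suc n}) /
           (2 * real (card X) * (2 * real (card X) - 1) ^ n)"
proof (cases "card X")
  case 0
  then show ?thesis
    by (simp add: frequency_def card_words_of_length[OF assms])
next
  case (Suc m)
  then have "real (2 * card X - 1) = 2 * real (card X) - 1"
    by (simp add: of_nat_diff)
  then show ?thesis
    by (simp add: frequency_def card_words_of_length[OF assms])
qed

lemma summable_frequency:
  assumes "finite X" "R \<subseteq> carrier (free_group X)" "0 < s" "s < 1"
  shows "summable (\<lambda>n. frequency X R n * (1 - s) ^ n)"
proof (rule summable_comparison_test')
  show "summable (\<lambda>n. (1 - s) ^ n)"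
    by (rule summable_geometric) (use assms in auto)
  show "norm (frequency X R n * (1 - s) ^ n) \<le> (1 - s) ^ n" if "n \<ge> 0" for n
    using frequency_bounds[OF assms(1,2), of n] assms(3,4)
    by (simp add: abs_mult mult_left_le_one_le)
qed

lemma mu_weight_words_of_length:
  assumes "finite X" "w \<in> words_of_length X n"
  shows "mu_weight X s w = s * (1 - s) ^ n / real (card (words_of_length X n))"
proof (cases n)
  case 0
  then have "words_of_length X n = {[]}"
    by (auto simp: words_of_length_def carrier_free_group)
  with 0 assms(2) show ?thesis
    by (simp add: mu_weight_def)
next
  case (Suc k)
  then have w: "w \<noteq> []" "length w = Suc k"
    using assms(2) by (auto simp: words_of_length_def)
  have "card (words_of_length X n) > 0"
    using assms finite_words_of_length by (auto simp: card_gt_0_iff)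
  then have "card X > 0"
    by (simp add: Suc card_words_of_length[OF assms(1)])
  then have "real (2 * card X - 1) = 2 * real (card X) - 1"
    by (simp add: of_nat_diff)
  with w show ?thesis
    by (simp add: Suc mu_weight_def card_words_of_length[OF assms(1)])
qed

lemma measure_mu_eq_suminf:
  assumes X: "finite X" and R: "R \<subseteq> carrier (free_group X)" and s: "0 < s" "s < 1"
  shows "measure (mu X s) R = s * (\<Sum>n. frequency X R n * (1 - s) ^ n)"
proof -
  let ?R = "\<lambda>n. {w \<in> R. length w = n}"
  let ?h = "\<Sum>n. frequency X R n * (1 - s) ^ n"
  have sub: "?R n \<subseteq> words_of_length X n" for n
    using R by (auto simp: words_of_length_def)
  have slice: "emeasure (mu X s) (?R n) = ennreal (s * (frequency X R n * (1 - s) ^ n))" for n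
  proof -
    have "emeasure (mu X s) (?R n) = (\<Sum>w\<in>?R n. ennreal (mu_weight X s w))"
      unfolding mu_def
      by (rule emeasure_point_measure_finite2)
         (use R finite_subset[OF sub finite_words_of_length[OF X]] in auto)
    also have "\<dots> = (\<Sum>w\<in>?R n. ennreal (s * (1 - s) ^ n / real (card (words_of_length X n))))"
      by (intro sum.cong refl arg_cong[of _ _ ennreal]
            mu_weight_words_of_length[OF X] subsetD[OF sub])
    also have "\<dots> = ennreal (\<Sum>w\<in>?R n. s * (1 - s) ^ n / real (card (words_of_length X n)))"
      by (rule sum_ennreal) (use s in auto)
    also have "(\<Sum>w\<in>?R n. s * (1 - s) ^ n / real (card (words_of_length X n)))
                 = s * (frequency X R n * (1 - s) ^ n)"
      by (simp add: frequency_def)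
    finally show ?thesis .
  qed
  have sums: "(\<lambda>n. s * (frequency X R n * (1 - s) ^ n)) sums (s * ?h)"
    by (intro sums_mult summable_sums summable_frequency assms)
  have nonneg: "0 \<le> s * (frequency X R n * (1 - s) ^ n)" for n
    using s frequency_bounds(1)[OF X R, of n] by simp
  have "emeasure (mu X s) R = emeasure (mu X s) (\<Union>n. ?R n)"
    by (rule arg_cong[of _ _ "emeasure (mu X s)"]) auto
  also have "\<dots> = (\<Sum>n. emeasure (mu X s) (?R n))"
    by (rule suminf_emeasure[symmetric])
       (use R in \<open>auto simp: mu_def sets_point_measure disjoint_family_on_def\<close>)
  also have "\<dots> = ennreal (s * ?h)"
    unfolding slice by (rule suminf_ennreal_eq[OF nonneg sums])
  finally show ?thesis
    using sums_le[OF nonneg sums_zero sums] by (simp add: measure_def)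
qed

text \<open>The sphere sizes form a geometric progression from length \<open>1\<close> on, so dividing by them turns a
  recurrence with coefficients \<open>c j\<close> into one with coefficients \<open>c j * (2 * card X - 1) ^ j\<close>.  The
  sphere of radius \<open>0\<close> does not fit the progression; a leading coefficient \<open>0\<close> makes the new
  recurrence start at length \<open>1\<close>.\<close>

lemma regular_frequency_rational:
  assumes X: "finite X" and reg: "regular_subset X R"
  obtains p q :: "real poly" where "q \<noteq> 0"
    "\<And>t. summable (\<lambda>n. frequency X R n * t ^ n) \<Longrightarrow>
       poly q t * (\<Sum>n. frequency X R n * t ^ n) = poly p t"
proof -
  let ?r = "\<lambda>n. real (card {w \<in> R. length w = n})"
  define \<rho> where "\<rho> = 2 * real (card X) - 1"
  have "2 * card X \<noteq> 1"
    by presburger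
  then have \<rho>: "\<rho> \<noteq> 0"
    unfolding \<rho>_def by linarith
  obtain c d i where c: "i \<le> d" "c i \<noteq> 0" and rec: "\<And>n. (\<Sum>j\<le>d. c j * ?r (n + j)) = 0"
    by (rule regular_language_growth_recurrence[of "letters X" R])
       (use finite_letters[OF X] reg in \<open>auto simp: regular_subset_def\<close>)
  define c' where "c' j = (case j of 0 \<Rightarrow> 0 | Suc k \<Rightarrow> c k * \<rho> ^ k)" for j
  have rec': "(\<Sum>j\<le>Suc d. c' j * frequency X R (n + j)) = 0" for n
  proof -
    have "(\<Sum>j\<le>Suc d. c' j * frequency X R (n + j))
            = (\<Sum>k\<le>d. c k * \<rho> ^ k * frequency X R (Suc (n + k)))"
      by (subst sum.atMost_Suc_shift) (simp add: c'_def)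
    also have "\<dots> = (\<Sum>k\<le>d. c k * ?r (Suc n + k) / (2 * real (card X) * \<rho> ^ n))"
      using \<rho> by (intro sum.cong refl)
        (simp add: frequency_Suc[OF X] power_add flip: \<rho>_def)
    also have "\<dots> = 0"
      using rec[of "Suc n"] by (simp flip: sum_divide_distrib)
    finally show ?thesis .
  qed
  have c': "Suc i \<le> Suc d" "c' (Suc i) \<noteq> 0"
    using c \<rho> by (simp_all add: c'_def)
  show ?thesis
    by (rule recurrence_imp_rational_power_series[OF c' rec'], rule that)
qed

section \<open>The dichotomy\<close>

theorem corollary3p4:
  fixes X :: "'x set" and R :: "'x letter list set"
  assumes "finite X"
    and "regular_subset X R"
  shows "thick_subset X R \<or> sparse_subset X R"
proof -
  have R: "R \<subseteq> carrier (free_group X)"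
    using assms(2) by (simp add: regular_subset_def)
  define h where "h s = (\<Sum>n. frequency X R n * (1 - s) ^ n)" for s
  \<comment> \<open>At \<open>s = 0\<close> the series may diverge, so everything is said for small positive \<open>s\<close>.\<close>
  have near_0: "\<forall>\<^sub>F s in at_right 0. 0 < s \<and> s < (1::real)"
    by (auto simp: eventually_at_right_field intro!: exI[of _ 1])
  have mu: "\<forall>\<^sub>F s in at_right 0. s * h s = measure (mu X s) R"
    using near_0 by eventually_elim (simp add: h_def measure_mu_eq_suminf[OF assms(1) R])
  have h: "\<forall>\<^sub>F s in at_right 0. h s = measure (mu X s) R / s"
    using near_0 mu by eventually_elim (simp add: field_simps)
  have bounded: "\<forall>\<^sub>F s in at_right 0. \<bar>s * h s\<bar> \<le> 1"
    using near_0
  proof eventually_elim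
    case (elim s)
    have "h s \<le> (\<Sum>n. (1 - s) ^ n)"
      unfolding h_def
      using elim frequency_bounds[OF assms(1) R]
      by (intro suminf_le summable_frequency assms(1) R summable_geometric)
         (auto intro!: mult_left_le_one_le)
    also have "\<dots> = 1 / s"
      using elim by (subst suminf_geometric) auto
    finally have "s * h s \<le> 1"
      using elim by (simp add: field_simps)
    moreover have "0 \<le> s * h s"
      using elim measure_mu_eq_suminf[OF assms(1) R, of s]
      by (metis h_def measure_nonneg)
    ultimately show ?case
      by simp
  qed
  obtain p q where "q \<noteq> 0" and pq: "\<And>t. summable (\<lambda>n. frequency X R n * t ^ n) \<Longrightarrow>
      poly q t * (\<Sum>n. frequency X R n * t ^ n) = poly p t"
    by (rule regular_frequency_rational[OF assms], rule that)
  \<comment> \<open>The series has argument \<open>t = 1 - s\<close>; rewrite it as a rational function of \<open>s\<close>.\<close>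
  have "pcompose q [:1, -1:] \<noteq> 0"
    using \<open>q \<noteq> 0\<close> by (simp add: pcompose_eq_0_iff)
  moreover have "\<forall>\<^sub>F s in at_right 0.
      poly (pcompose q [:1, -1:]) s * h s = poly (pcompose p [:1, -1:]) s"
    using near_0
    by eventually_elim (simp add: h_def poly_pcompose pq summable_frequency[OF assms(1) R])
  ultimately consider l where "l \<noteq> 0" "((\<lambda>s. s * h s) \<longlongrightarrow> l) (at_right 0)"
    | l where "(h \<longlongrightarrow> l) (at_right 0)"
    using rational_at_most_simple_pole[OF _ _ bounded] by blast
  then show ?thesis
  proof cases
    case 1
    then have "mu0_is X R l"
      unfolding mu0_is_def using Lim_transform_eventually[OF _ mu] by blast
    moreover from this have "0 \<le> l"
      unfolding mu0_is_def by (rule tendsto_lowerbound) simp_all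
    ultimately show ?thesis
      using 1 unfolding thick_subset_def by force
  next
    case 2
    then have "((\<lambda>s. s * h s) \<longlongrightarrow> 0 * l) (at_right 0)"
      by (intro tendsto_mult tendsto_ident_at)
    then have "mu0_is X R 0"
      unfolding mu0_is_def using Lim_transform_eventually[OF _ mu] by simp
    moreover have "mu1_is X R l"
      unfolding mu1_is_def using Lim_transform_eventually[OF 2 h] .
    ultimately show ?thesis
      unfolding sparse_subset_def by blast
  qed
qed

end
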